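(* Let $L$ be a flat virtual link such that, for every pair of distinct components $A,B$, the number of $+$ ends of $AB$-crossings on $A$ equals the number of $-$ ends of $AB$-crossings on $A$. If $L$ has a filamentation, then $p_L\equiv 0$.
   Context: Gauss codes. A flat virtual link $L$ is given by a Gauss code: a finite set of crossings together with a finite collection of cyclic words (codewords), one for each component, in the signed letters $x^+,x^-$ ($x$ a crossing), such that for each crossing $x$ each of the two letters $x^+$ and $x^-$ occurs exactly once in total over all codewords. A component and its codeword are denoted by the same symbol $A$. Notation. For distinct letters $x^\epsilon,y^\delta$ of the same codeword $A$, $\eta_A(x^\epsilon,y^\delta)$ is the number of $+$ letters minus the number of $-$ letters encountered as one cycles forward through $A$ from $x^\epsilon$ to $y^\delta$, not including these two letters. $\mathcal K(A)$ is the set of self-crossings of $A$, i.e. crossings $x$ with both $x^+$ and $x^-$ in $A$. For distinct components $A,B$, an $AB$-crossing is a crossing with one of its two letters in $A$ and the other in $B$. By the assumption on equal numbers of $+$ and $-$ ends, the $AB$-crossings can be partitioned (arbitrarily) into pairs $\{x,y\}$ such that $x^+$ and $y^-$ are in the same one of $A$ and $B$; $\mathcal P(A,B)$ denotes the set of pairs in a chosen such partition. The polynomial. With one variable $t_A$ for each component $A$ and one variable $t_{A,B}$ for each unordered pair of distinct components, set $$p_A(t_A)=\sum_{x\in\mathcal K(A)}\eta_A(x^+,x^-)\,t_A^{|\eta_A(x^+,x^-)|},$$ $$p_{A,B}(t_{A,B})=t_{A,B}\sum_{\{x,y\}\in\mathcal P(A,B)}\left(\eta_A(x^+,y^-)+\eta_B(y^+,x^-)\right),$$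 where in the second sum the labelling of each pair is chosen so that $x^+,y^-$ are in $A$ and $x^-,y^+$ are in $B$. Then $$p_L=\sum_{A}p_A(t_A)+\sum_{\{A,B\}}p_{A,B}(t_{A,B}),$$ the sums being over all components $A$ and all unordered pairs of distinct components $\{A,B\}$. The polynomial $p_L$ does not depend on the choice of the partitions $\mathcal P(A,B)$. Filamentations. A filamentation of $L$ is a partition of the set of all crossings of the Gauss code into singletons (monofilaments) and pairs (bifilaments) such that: for each monofilament $\{x\}$, $x^+$ and $x^-$ are in the same codeword $A$ and $\eta_A(x^+,x^-)=0$; and for each bifilament $\{x,y\}$, $x^+$ and $y^-$ are in the same codeword $A$, $x^-$ and $y^+$ are in the same codeword $B$ (possibly $A=B$), and $\eta_A(x^+,y^-)+\eta_B(y^+,x^-)=0$. *)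

theory Defs
  imports "HOL-Library.Poly_Mapping" "HOL-Library.Disjoint_Sets"
begin

datatype 'x letter = Plus_end (crossing: 'x) | Minus_end (crossing: 'x)

primrec letter_sign :: "'x letter \<Rightarrow> int" where
  "letter_sign (Plus_end x) = 1"
| "letter_sign (Minus_end x) = -1"

text \<open>
  A code is the list of its codewords. The components are the indices \<open>A < length G\<close>, with
  codeword \<open>G ! A\<close>, so that several crossingless components (empty codewords) remain distinct.
  Each cyclic word is given by a list, read cyclically; see \<open>eta_rotate\<close> below.
\<close>

type_synonym 'x code = "'x letter list list"

definition crossings :: "'x code \<Rightarrow> 'x set" where
  "crossings G = crossing ` set (concat G)"

definition gauss_code :: "'x code \<Rightarrow> bool" where
  "gauss_code G \<longleftrightarrow>
     (\<forall>x\<in>crossings G. count_list (concat G) (Plus_end x) = 1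
                  \<and> count_list (concat G) (Minus_end x) = 1)"

definition rotate_to :: "'a \<Rightarrow> 'a list \<Rightarrow> 'a list" where
  "rotate_to a w = dropWhile (\<lambda>c. c \<noteq> a) w @ takeWhile (\<lambda>c. c \<noteq> a) w"

text \<open>
  Meaningful for distinct letters \<open>a\<close>, \<open>b\<close> of \<open>w\<close>. The head of \<open>rotate_to a w\<close> is \<open>a\<close> itself,
  so the sum runs over the letters strictly between \<open>a\<close> and \<open>b\<close>.
\<close>

definition eta :: "'x letter list \<Rightarrow> 'x letter \<Rightarrow> 'x letter \<Rightarrow> int" where
  "eta w a b = (\<Sum>c\<leftarrow>takeWhile (\<lambda>c. c \<noteq> b) (tl (rotate_to a w)). letter_sign c)"

lemma eta_rotate:
  assumes "distinct w" "a \<in> set w"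
  shows "eta (rotate n w) a b = eta w a b"
proof -
  have step: "rotate_to a (rotate1 v) = rotate_to a v" if "distinct v" "a \<in> set v" for v
  proof (cases v)
    case Nil
    then show ?thesis by simp
  next
    case (Cons c us)
    show ?thesis
    proof (cases "c = a")
      case True
      with Cons that have "\<forall>d\<in>set us. d \<noteq> a" by auto
      with Cons True show ?thesis
        by (simp add: rotate_to_def dropWhile_append takeWhile_append)
    next
      case False
      with Cons that have "a \<in> set us" by auto
      with Cons False show ?thesis
        by (auto simp: rotate_to_def dropWhile_append takeWhile_append)
    qed
  qed
  have "rotate_to a (rotate n w) = rotate_to a w"
  proof (induction n)
    case (Suc n)
    then show ?case using step[of "rotate n w"] assms by simp
  qed simp
  then show ?thesis by (simp add: eta_def)
qed

definition self_crossings :: "'x code \<Rightarrow> nat \<Rightarrow> 'x set" where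
  "self_crossings G A =
     {x \<in> crossings G. Plus_end x \<in> set (G ! A) \<and> Minus_end x \<in> set (G ! A)}"

definition mixed_crossings :: "'x code \<Rightarrow> nat \<Rightarrow> nat \<Rightarrow> 'x set" where
  "mixed_crossings G A B =
     {x \<in> crossings G. Plus_end x \<in> set (G ! A) \<and> Minus_end x \<in> set (G ! B)
                     \<or> Plus_end x \<in> set (G ! B) \<and> Minus_end x \<in> set (G ! A)}"

definition balanced :: "'x code \<Rightarrow> bool" where
  "balanced G \<longleftrightarrow>
     (\<forall>A<length G. \<forall>B<length G. A \<noteq> B \<longrightarrow>
        card {x \<in> mixed_crossings G A B. Plus_end x \<in> set (G ! A)}
      = card {x \<in> mixed_crossings G A B. Minus_end x \<in> set (G ! A)})"

definition is_pairing :: "'x code \<Rightarrow> nat \<Rightarrow> nat \<Rightarrow> 'x set set \<Rightarrow> bool" where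
  "is_pairing G A B Q \<longleftrightarrow>
     partition_on (mixed_crossings G A B) Q \<and>
     (\<forall>p\<in>Q. \<exists>x y. p = {x, y} \<and> x \<noteq> y \<and>
        (\<exists>C\<in>{A, B}. Plus_end x \<in> set (G ! C) \<and> Minus_end y \<in> set (G ! C)))"

text \<open>A simultaneous choice of partitions, one for each unordered pair of distinct components.\<close>

definition pairing_choice :: "'x code \<Rightarrow> (nat set \<Rightarrow> 'x set set) \<Rightarrow> bool" where
  "pairing_choice G P \<longleftrightarrow>
     (\<forall>A<length G. \<forall>B<length G. A \<noteq> B \<longrightarrow> is_pairing G A B (P {A, B}))"

datatype link_var = Comp_var nat | Pair_var "nat set"

text \<open>Integer polynomials, as finitely supported maps from monomials to coefficients.\<close>

type_synonym link_polynomial = "(link_var \<Rightarrow>\<^sub>0 nat) \<Rightarrow>\<^sub>0 int"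

definition monomial_term :: "int \<Rightarrow> link_var \<Rightarrow> nat \<Rightarrow> link_polynomial" where
  "monomial_term c v k = Poly_Mapping.single (Poly_Mapping.single v k) c"

definition component_poly :: "'x code \<Rightarrow> nat \<Rightarrow> link_polynomial" where
  "component_poly G A =
     (\<Sum>x\<in>self_crossings G A.
        monomial_term (eta (G ! A) (Plus_end x) (Minus_end x)) (Comp_var A)
          (nat \<bar>eta (G ! A) (Plus_end x) (Minus_end x)\<bar>))"

text \<open>
  For distinct \<open>A\<close> and \<open>B\<close>, every pair in a pairing of a Gauss code has exactly one admissible
  labelling, so summing over labelled pairs is the same as summing over the pairs.
\<close>

definition labelled_pairs :: "'x code \<Rightarrow> nat \<Rightarrow> nat \<Rightarrow> 'x set set \<Rightarrow> ('x \<times> 'x) set" where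
  "labelled_pairs G A B Q =
     {(x, y). {x, y} \<in> Q \<and> Plus_end x \<in> set (G ! A) \<and> Minus_end y \<in> set (G ! A)
                         \<and> Minus_end x \<in> set (G ! B) \<and> Plus_end y \<in> set (G ! B)}"

definition pair_poly :: "'x code \<Rightarrow> nat \<Rightarrow> nat \<Rightarrow> 'x set set \<Rightarrow> link_polynomial" where
  "pair_poly G A B Q =
     monomial_term
       (\<Sum>(x, y)\<in>labelled_pairs G A B Q.
          eta (G ! A) (Plus_end x) (Minus_end y) + eta (G ! B) (Plus_end y) (Minus_end x))
       (Pair_var {A, B}) 1"

text \<open>
  \<open>pair_poly\<close> is symmetric in \<open>A\<close> and \<open>B\<close>, so the condition \<open>A < B\<close> only serves to count each
  unordered pair of components once.
\<close>

definition link_poly :: "'x code \<Rightarrow> (nat set \<Rightarrow> 'x set set) \<Rightarrow> link_polynomial" where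
  "link_poly G P =
     (\<Sum>A<length G. component_poly G A) +
     (\<Sum>(A, B)\<in>{(A, B). A < B \<and> B < length G}. pair_poly G A B (P {A, B}))"

lemma labelled_pairs_commute: "labelled_pairs G B A Q = prod.swap ` labelled_pairs G A B Q"
  by (auto simp: labelled_pairs_def insert_commute image_iff)

lemma pair_poly_commute: "pair_poly G B A Q = pair_poly G A B Q"
proof -
  have "(\<Sum>(x, y)\<in>labelled_pairs G B A Q.
           eta (G ! B) (Plus_end x) (Minus_end y) + eta (G ! A) (Plus_end y) (Minus_end x))
      = (\<Sum>(x, y)\<in>labelled_pairs G A B Q.
           eta (G ! A) (Plus_end x) (Minus_end y) + eta (G ! B) (Plus_end y) (Minus_end x))"
    unfolding labelled_pairs_commute[of G B A]
    by (subst sum.reindex) (auto simp: case_prod_beta add.commute intro!: sum.cong)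
  then show ?thesis by (simp add: pair_poly_def insert_commute)
qed

definition monofilament :: "'x code \<Rightarrow> 'x set \<Rightarrow> bool" where
  "monofilament G f \<longleftrightarrow>
     (\<exists>x. f = {x} \<and> (\<exists>A<length G.
        Plus_end x \<in> set (G ! A) \<and> Minus_end x \<in> set (G ! A) \<and>
        eta (G ! A) (Plus_end x) (Minus_end x) = 0))"

definition bifilament :: "'x code \<Rightarrow> 'x set \<Rightarrow> bool" where
  "bifilament G f \<longleftrightarrow>
     (\<exists>x y. f = {x, y} \<and> x \<noteq> y \<and> (\<exists>A<length G. \<exists>B<length G.
        Plus_end x \<in> set (G ! A) \<and> Minus_end y \<in> set (G ! A) \<and>
        Minus_end x \<in> set (G ! B) \<and> Plus_end y \<in> set (G ! B) \<and>
        eta (G ! A) (Plus_end x) (Minus_end y) + eta (G ! B) (Plus_end y) (Minus_end x) = 0))"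

definition filamentation :: "'x code \<Rightarrow> 'x set set \<Rightarrow> bool" where
  "filamentation G F \<longleftrightarrow>
     partition_on (crossings G) F \<and> (\<forall>f\<in>F. monofilament G f \<or> bifilament G f)"

lemma gauss_code_unique_component:
  assumes G: "gauss_code G" and "A < length G" "B < length G"
    and "c \<in> set (G ! A)" "c \<in> set (G ! B)"
  shows "A = B"
proof (rule ccontr)
  have main: False if ij: "i < j" "j < length G" "c \<in> set (G ! i)" "c \<in> set (G ! j)" for i j
  proof -
    have i: "c \<in> set (concat (take j G))"
      using ij by (fastforce simp: in_set_conv_nth)
    have j: "c \<in> set (concat (drop j G))"
      using ij by (fastforce simp: in_set_conv_nth Cons_nth_drop_Suc[symmetric])
    have "concat G = concat (take j G) @ concat (drop j G)"
      by (metis append_take_drop_id concat_append)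
    then have "count_list (concat G) c
        = count_list (concat (take j G)) c + count_list (concat (drop j G)) c"
      by simp
    moreover have "count_list (concat (take j G)) c \<noteq> 0" "count_list (concat (drop j G)) c \<noteq> 0"
      using i j by (simp_all add: count_list_0_iff del: set_concat)
    moreover have "count_list (concat G) c = 1"
    proof -
      have "G ! j \<in> set G" using ij by simp
      then have "c \<in> set (concat G)" using ij by auto
      then have "crossing c \<in> crossings G" unfolding crossings_def by blast
      then show ?thesis using G unfolding gauss_code_def by (cases c) auto
    qed
    ultimately show False by linarith
  qed
  assume "A \<noteq> B"
  then show False using main[of A B] main[of B A] assms by (cases A B rule: linorder_cases) auto
qed

text \<open>The balance condition guarantees that pairing choices exist.\<close>

lemma is_pairing_commute: "is_pairing G A B Q \<longleftrightarrow> is_pairing G B A Q"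
proof -
  have "mixed_crossings G A B = mixed_crossings G B A" by (auto simp: mixed_crossings_def)
  moreover have "{A, B} = {B, A}" by auto
  ultimately show ?thesis unfolding is_pairing_def by presburger
qed

lemma partition_on_matching:
  assumes f: "bij_betw f S T" and disj: "S \<inter> T = {}"
  shows "partition_on (S \<union> T) ((\<lambda>x. {x, f x}) ` S)"
proof (rule partition_onI)
  have img: "f ` S = T" using f by (rule bij_betw_imp_surj_on)
  then show "\<Union>((\<lambda>x. {x, f x}) ` S) = S \<union> T" by blast
  fix p q assume pq: "p \<in> (\<lambda>x. {x, f x}) ` S" "q \<in> (\<lambda>x. {x, f x}) ` S" "p \<noteq> q"
  then obtain x y where xy: "x \<in> S" "y \<in> S" "p = {x, f x}" "q = {y, f y}" by blast
  have "x \<noteq> y" using pq(3) xy by auto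
  moreover have "f x \<noteq> f y"
    using \<open>x \<noteq> y\<close> xy(1,2) f by (metis bij_betw_imp_inj_on inj_onD)
  moreover have "f x \<in> T" "f y \<in> T" using img xy(1,2) by auto
  ultimately show "disjnt p q" using disj xy by (auto simp: disjnt_def)
qed auto

lemma is_pairing_exists:
  assumes G: "gauss_code G" "balanced G" and AB: "A < length G" "B < length G" "A \<noteq> B"
  shows "\<exists>Q. is_pairing G A B Q"
proof -
  define S where "S = {x \<in> mixed_crossings G A B. Plus_end x \<in> set (G ! A)}"
  define T where "T = {x \<in> mixed_crossings G A B. Minus_end x \<in> set (G ! A)}"
  have "finite (mixed_crossings G A B)" by (simp add: mixed_crossings_def crossings_def)
  then have fin: "finite S" "finite T" by (simp_all add: S_def T_def)
  have "card S = card T" using G(2) AB by (simp add: balanced_def S_def T_def)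
  with fin obtain f where f: "bij_betw f S T"
    using finite_same_card_bij by metis
  have disj: "S \<inter> T = {}"
  proof (rule ccontr)
    assume "S \<inter> T \<noteq> {}"
    then obtain x where "Plus_end x \<in> set (G ! A)" "Minus_end x \<in> set (G ! A)"
      "x \<in> mixed_crossings G A B"
      by (auto simp: S_def T_def)
    then obtain c where "c \<in> set (G ! A)" "c \<in> set (G ! B)"
      by (auto simp: mixed_crossings_def)
    then show False using gauss_code_unique_component[OF G(1) AB(1,2)] AB(3) by metis
  qed
  have un: "mixed_crossings G A B = S \<union> T" by (auto simp: mixed_crossings_def S_def T_def)
  have "is_pairing G A B ((\<lambda>x. {x, f x}) ` S)"
    unfolding is_pairing_def
  proof (intro conjI ballI)
    show "partition_on (mixed_crossings G A B) ((\<lambda>x. {x, f x}) ` S)"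
      unfolding un using f disj by (rule partition_on_matching)
    fix p assume "p \<in> (\<lambda>x. {x, f x}) ` S"
    then obtain x where x: "x \<in> S" "p = {x, f x}" by blast
    have fx: "f x \<in> T" using f x(1) by (rule bij_betw_apply)
    then have "x \<noteq> f x" using disj x(1) by auto
    moreover have "Plus_end x \<in> set (G ! A)" using x(1) by (simp add: S_def)
    moreover have "Minus_end (f x) \<in> set (G ! A)" using fx by (simp add: T_def)
    ultimately show "\<exists>x y. p = {x, y} \<and> x \<noteq> y \<and>
        (\<exists>C\<in>{A, B}. Plus_end x \<in> set (G ! C) \<and> Minus_end y \<in> set (G ! C))"
      by (intro exI[of _ x] exI[of _ "f x"]) (simp add: x(2))
  qed
  then show ?thesis ..
qed

lemma pairing_choice_exists:
  assumes "gauss_code G" "balanced G"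
  shows "\<exists>P. pairing_choice G P"
proof -
  define P where "P D = (SOME Q. is_pairing G (Min D) (Max D) Q)" for D
  have "is_pairing G A B (P {A, B})" if "A < length G" "B < length G" "A \<noteq> B" for A B
  proof -
    have ex: "\<exists>Q. is_pairing G (min A B) (max A B) Q"
      using is_pairing_exists[OF assms] that by (simp add: min_def max_def)
    have "is_pairing G (min A B) (max A B) (P {A, B})"
      using someI_ex[OF ex] by (simp add: P_def)
    then show ?thesis
      using is_pairing_commute[of G A B] by (auto simp: min_def max_def split: if_splits)
  qed
  then show ?thesis unfolding pairing_choice_def by blast
qed

end

theory Submission imports Defs
begin

text \<open>
  The idea is that \<open>\<eta>\<close> is a difference of values of one potential. By the balance condition the
  signs on each codeword add up to zero, so the partial sums of signs return to their initial value
  after a full turn around the cyclic word: if \<open>H c\<close> is the sum of the signs before the letter \<open>c\<close>, then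
  \<open>\<eta>(a, b) = H b - H a - sign a\<close>, whether or not the path from \<open>a\<close> to \<open>b\<close> passes the base point
  (\<open>eta_code_height\<close>).

  Let \<open>\<theta> x = H (x\<^sup>-) - H (x\<^sup>+) - 1\<close> be the weight of the crossing \<open>x\<close>. Then
  \<open>\<eta>(x\<^sup>+, x\<^sup>-) = \<theta> x\<close> for every self-crossing, and
  \<open>\<eta>(x\<^sup>+, y\<^sup>-) + \<eta>(y\<^sup>+, x\<^sup>-) = \<theta> x + \<theta> y\<close> for every pair of crossings that may be a
  bifilament or a member of a pairing: the two ends of the paths are merely regrouped. Hence a
  filamentation is a partition of the crossings on each block of which the weights cancel, and each
  block lies inside one of the sets of self-crossings of \<open>A\<close> or of \<open>AB\<close>-crossings.

  The coefficient in \<open>p\<^sub>A\<^sub>,\<^sub>B\<close> is the sum of the weights of all \<open>AB\<close>-crossings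
  (\<open>sum_labelled_pairs\<close>; the pairing has disappeared), which cancels block by block. In
  \<open>p\<^sub>A\<close> the crossing \<open>x\<close> contributes \<open>\<theta> x\<close> times the power \<open>\<bar>\<theta> x\<bar>\<close> of \<open>t\<^sub>A\<close>, an odd function of
  the weight, so these contributions also cancel block by block.
\<close>

section \<open>Heights and path sums in a cyclic word\<close>

definition height :: "'x letter list \<Rightarrow> 'x letter \<Rightarrow> int" where
  "height w c = (\<Sum>d\<leftarrow>takeWhile (\<lambda>d. d \<noteq> c) w. letter_sign d)"

text \<open>
  When \<open>b\<close> precedes \<open>a\<close> in the list, the path from \<open>a\<close> to \<open>b\<close> passes the end of the list and the
  formula is off by the sum of the whole word, which vanishes here.
\<close>

lemma eta_eq_height_diff:
  assumes "distinct w" "(\<Sum>c\<leftarrow>w. letter_sign c) = 0" "a \<in> set w" "b \<in> set w" "a \<noteq> b"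
  shows "eta w a b = height w b - height w a - letter_sign a"
proof -
  obtain u v where w: "w = u @ a # v" and a: "a \<notin> set u"
    using split_list_first[OF assms(3)] by blast
  have tw: "takeWhile (\<lambda>c. c \<noteq> a) (u @ a # v) = u"
    and dw: "dropWhile (\<lambda>c. c \<noteq> a) (u @ a # v) = a # v"
    using a by (auto simp: takeWhile_append dropWhile_append)
  have rot: "tl (rotate_to a w) = v @ u"
    by (simp only: w rotate_to_def tw dw) simp
  have ha: "height w a = (\<Sum>c\<leftarrow>u. letter_sign c)"
    by (simp only: height_def w tw)
  show ?thesis
  proof (cases "b \<in> set v")
    case True
    then have "b \<notin> set u" using assms(1) w by auto
    then have "takeWhile (\<lambda>d. d \<noteq> b) w = u @ a # takeWhile (\<lambda>d. d \<noteq> b) v"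
      using w assms(5) by (auto simp: takeWhile_append)
    moreover have "takeWhile (\<lambda>d. d \<noteq> b) (v @ u) = takeWhile (\<lambda>d. d \<noteq> b) v"
      using True by (auto simp: takeWhile_append)
    ultimately show ?thesis
      unfolding eta_def rot ha height_def[of w b] by simp
  next
    case False
    then have "b \<in> set u" using assms(4,5) w by auto
    then have "takeWhile (\<lambda>d. d \<noteq> b) w = takeWhile (\<lambda>d. d \<noteq> b) u"
      using w by (auto simp: takeWhile_append)
    moreover have "takeWhile (\<lambda>d. d \<noteq> b) (v @ u) = v @ takeWhile (\<lambda>d. d \<noteq> b) u"
      using False by (auto simp: takeWhile_append)
    ultimately show ?thesis
      unfolding eta_def rot ha height_def[of w b] using assms(2) w by simp
  qed
qed

section \<open>Letters and components of a Gauss code\<close>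

lemma letter_in_concat:
  assumes "A < length G" "c \<in> set (G ! A)"
  shows "c \<in> set (concat G)"
  using assms by auto

lemma crossing_in_crossings:
  assumes "A < length G" "c \<in> set (G ! A)"
  shows "crossing c \<in> crossings G"
  using letter_in_concat[OF assms] unfolding crossings_def by blast

lemma distinct_if_count_list_le_1:
  assumes "\<And>c. count_list xs c \<le> 1"
  shows "distinct xs"
  using assms
proof (induction xs)
  case (Cons d xs)
  have "count_list xs c \<le> 1" for c
    using Cons.prems[of c] by (simp split: if_splits)
  moreover have "count_list xs d = 0"
    using Cons.prems[of d] by simp
  ultimately show ?case using Cons.IH by (simp add: count_list_0_iff)
qed simp

lemma gauss_code_distinct:
  assumes "gauss_code G"
  shows "distinct (concat G)"
proof (rule distinct_if_count_list_le_1)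
  fix c
  show "count_list (concat G) c \<le> 1"
  proof (cases "c \<in> set (concat G)")
    case True
    then have "crossing c \<in> crossings G" unfolding crossings_def by blast
    then have "count_list (concat G) c = 1"
      using assms unfolding gauss_code_def by (cases c) auto
    then show ?thesis by simp
  next
    case False
    then have "count_list (concat G) c = 0" by (simp only: count_list_0_iff not_False_eq_True)
    then show ?thesis by linarith
  qed
qed

lemma distinct_codeword:
  assumes "gauss_code G" "A < length G"
  shows "distinct (G ! A)"
  using gauss_code_distinct[OF assms(1)] assms(2) by (auto simp: distinct_concat_iff)

lemma gauss_code_component_exists:
  assumes "gauss_code G" "crossing c \<in> crossings G"
  shows "\<exists>A<length G. c \<in> set (G ! A)"
proof -
  have "count_list (concat G) c = 1"
    using assms unfolding gauss_code_def by (cases c) auto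
  then have "c \<in> set (concat G)" by (metis count_list_0_iff zero_neq_one)
  then obtain w where "w \<in> set G" "c \<in> set w" by auto
  then show ?thesis by (metis in_set_conv_nth)
qed

section \<open>Balanced codewords\<close>

definition crossings_from_to :: "'x code \<Rightarrow> nat \<Rightarrow> nat \<Rightarrow> 'x set" where
  "crossings_from_to G A B = {x. Plus_end x \<in> set (G ! A) \<and> Minus_end x \<in> set (G ! B)}"

lemma finite_ends:
  "finite {x. Plus_end x \<in> set (w :: 'x letter list)}"
  "finite {x. Minus_end x \<in> set (w :: 'x letter list)}"
  using finite_vimageI[of "set w" Plus_end] finite_vimageI[of "set w" Minus_end]
  by (simp_all add: vimage_def inj_def)

lemma card_crossings_from_to_commute:
  assumes "gauss_code G" "balanced G" "A < length G" "B < length G"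
  shows "card (crossings_from_to G A B) = card (crossings_from_to G B A)"
proof (cases "A = B")
  case False
  have uniq: "c \<notin> set (G ! B)" if "c \<in> set (G ! A)" for c
    using gauss_code_unique_component[OF assms(1,3,4) that] False by blast
  have cr: "x \<in> crossings G" if "Plus_end x \<in> set (G ! A) \<or> Plus_end x \<in> set (G ! B)" for x
    using that crossing_in_crossings[of _ G "Plus_end x"] assms(3,4) by auto
  have "{x \<in> mixed_crossings G A B. Plus_end x \<in> set (G ! A)} = crossings_from_to G A B"
    "{x \<in> mixed_crossings G A B. Minus_end x \<in> set (G ! A)} = crossings_from_to G B A"
    unfolding mixed_crossings_def crossings_from_to_def using uniq cr by blast+
  moreover have "card {x \<in> mixed_crossings G A B. Plus_end x \<in> set (G ! A)}
      = card {x \<in> mixed_crossings G A B. Minus_end x \<in> set (G ! A)}"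
    using assms False by (simp add: balanced_def)
  ultimately show ?thesis by simp
qed simp

text \<open>
  The other end of each letter on \<open>A\<close> lies on some component \<open>B\<close>. The balance condition cancels the
  signs of the letters for each \<open>B \<noteq> A\<close>, and self-crossings cancel by themselves.
\<close>

lemma sum_signs_codeword_eq_0:
  assumes G: "gauss_code G" "balanced G" and A: "A < length G"
  shows "(\<Sum>c\<leftarrow>G ! A. letter_sign c) = 0"
proof -
  define X where "X = {x. Plus_end x \<in> set (G ! A)}"
  define Y where "Y = {x. Minus_end x \<in> set (G ! A)}"
  have fin: "finite X" "finite Y" unfolding X_def Y_def by (rule finite_ends)+
  have X: "X = (\<Union>B<length G. crossings_from_to G A B)"
  proof -
    have "\<exists>B<length G. Minus_end x \<in> set (G ! B)" if "x \<in> X" for x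
      using gauss_code_component_exists[OF G(1), of "Minus_end x"] that
        crossing_in_crossings[OF A, of "Plus_end x"] by (simp add: X_def)
    then show ?thesis by (auto simp: X_def crossings_from_to_def)
  qed
  have Y: "Y = (\<Union>B<length G. crossings_from_to G B A)"
  proof -
    have "\<exists>B<length G. Plus_end x \<in> set (G ! B)" if "x \<in> Y" for x
      using gauss_code_component_exists[OF G(1), of "Plus_end x"] that
        crossing_in_crossings[OF A, of "Minus_end x"] by (simp add: Y_def)
    then show ?thesis by (auto simp: Y_def crossings_from_to_def)
  qed
  have "card X = (\<Sum>B<length G. card (crossings_from_to G A B))"
    unfolding X
  proof (rule card_UN_disjoint)
    show "\<forall>B\<in>{..<length G}. finite (crossings_from_to G A B)"
      by (auto simp: crossings_from_to_def intro: finite_subset[OF _ finite_ends(1)])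
    show "\<forall>B\<in>{..<length G}. \<forall>C\<in>{..<length G}. B \<noteq> C \<longrightarrow>
        crossings_from_to G A B \<inter> crossings_from_to G A C = {}"
      using gauss_code_unique_component[OF G(1)] by (fastforce simp: crossings_from_to_def)
  qed simp
  also have "\<dots> = (\<Sum>B<length G. card (crossings_from_to G B A))"
    using card_crossings_from_to_commute[OF G A] by (intro sum.cong) auto
  also have "\<dots> = card Y"
    unfolding Y
  proof (rule card_UN_disjoint[symmetric])
    show "\<forall>B\<in>{..<length G}. finite (crossings_from_to G B A)"
      by (auto simp: crossings_from_to_def intro: finite_subset[OF _ finite_ends(2)])
    show "\<forall>B\<in>{..<length G}. \<forall>C\<in>{..<length G}. B \<noteq> C \<longrightarrow>
        crossings_from_to G B A \<inter> crossings_from_to G C A = {}"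
      using gauss_code_unique_component[OF G(1)] by (fastforce simp: crossings_from_to_def)
  qed simp
  finally have card: "card X = card Y" .
  have "c \<in> Plus_end ` X \<union> Minus_end ` Y" if "c \<in> set (G ! A)" for c
    by (cases c) (use that in \<open>simp_all add: X_def Y_def\<close>)
  then have set: "set (G ! A) = Plus_end ` X \<union> Minus_end ` Y"
    by (auto simp: X_def Y_def)
  have "(\<Sum>c\<leftarrow>G ! A. letter_sign c) = (\<Sum>c\<in>set (G ! A). letter_sign c)"
    using distinct_codeword[OF G(1) A] by (rule sum_list_distinct_conv_sum_set)
  also have "\<dots> = (\<Sum>c\<in>Plus_end ` X. letter_sign c) + (\<Sum>c\<in>Minus_end ` Y. letter_sign c)"
    unfolding set using fin by (intro sum.union_disjoint) auto
  also have "\<dots> = int (card X) - int (card Y)"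
    by (simp add: sum.reindex inj_on_def)
  finally show ?thesis using card by simp
qed

section \<open>Crossing weights\<close>

text \<open>
  Since every codeword sums to zero, the codewords before \<open>A\<close> do not change the heights on \<open>A\<close>, and
  the concatenation of all codewords carries the heights on all components at once. This frees the
  weight of a crossing from any mention of the components of its two ends.
\<close>

definition crossing_weight :: "'x code \<Rightarrow> 'x \<Rightarrow> int" where
  "crossing_weight G x = height (concat G) (Minus_end x) - height (concat G) (Plus_end x) - 1"

lemma height_concat:
  assumes G: "gauss_code G" "balanced G" and A: "A < length G" and c: "c \<in> set (G ! A)"
  shows "height (concat G) c = height (G ! A) c"
proof -
  have split: "concat G = concat (take A G) @ G ! A @ concat (drop (Suc A) G)"
    using id_take_nth_drop[OF A] by (metis concat.simps(2) concat_append)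
  have "c \<notin> set (concat (take A G))"
    using gauss_code_distinct[OF G(1)] c by (subst (asm) split) (auto simp del: set_concat)
  then have tw: "takeWhile (\<lambda>d. d \<noteq> c) (concat G)
      = concat (take A G) @ takeWhile (\<lambda>d. d \<noteq> c) (G ! A)"
    by (subst split) (use c in \<open>auto simp: takeWhile_append simp del: set_concat\<close>)
  have zero: "(\<Sum>d\<leftarrow>concat ws. letter_sign d) = 0"
    if "\<forall>w\<in>set ws. (\<Sum>d\<leftarrow>w. letter_sign d) = 0" for ws :: "'a code"
    using that by (induction ws) auto
  have "\<forall>w\<in>set (take A G). (\<Sum>d\<leftarrow>w. letter_sign d) = 0"
    using sum_signs_codeword_eq_0[OF G] by (metis in_set_conv_nth in_set_takeD)
  then show ?thesis
    unfolding height_def tw using zero by simp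
qed

lemma eta_code_height:
  assumes G: "gauss_code G" "balanced G" and A: "A < length G"
    and "a \<in> set (G ! A)" "b \<in> set (G ! A)" "a \<noteq> b"
  shows "eta (G ! A) a b = height (concat G) b - height (concat G) a - letter_sign a"
  using eta_eq_height_diff[OF distinct_codeword[OF G(1) A] sum_signs_codeword_eq_0[OF G A]]
    height_concat[OF G A] assms(4-6) by simp

lemma eta_self_crossing:
  assumes "gauss_code G" "balanced G" "A < length G"
    and "Plus_end x \<in> set (G ! A)" "Minus_end x \<in> set (G ! A)"
  shows "eta (G ! A) (Plus_end x) (Minus_end x) = crossing_weight G x"
  using eta_code_height[OF assms] by (simp add: crossing_weight_def)

lemma eta_pair:
  assumes "gauss_code G" "balanced G" "A < length G" "B < length G"
    and "Plus_end x \<in> set (G ! A)" "Minus_end y \<in> set (G ! A)"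
    and "Minus_end x \<in> set (G ! B)" "Plus_end y \<in> set (G ! B)"
  shows "eta (G ! A) (Plus_end x) (Minus_end y) + eta (G ! B) (Plus_end y) (Minus_end x)
       = crossing_weight G x + crossing_weight G y"
  using eta_code_height[OF assms(1-3,5,6)] eta_code_height[OF assms(1,2,4,8,7)]
  by (simp add: crossing_weight_def)

section \<open>Cancellation along a filamentation\<close>

text \<open>
  A set \<open>T\<close> of crossings inherits the cancellations of the filamentation if no bifilament crosses
  its boundary. The saturation hypothesis asks this of every pair whose ends are placed like those
  of a bifilament, so it can be checked from the components of the ends alone. For a
  monofilament oddness is used at weight zero, where it says only \<open>2 * g 0 = 0\<close>; hence the separate
  assumption on \<open>g 0\<close>, as the values of \<open>g\<close> may lie in a group with torsion.
\<close>

lemma filamentation_sum_eq_0: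
  fixes g :: "int \<Rightarrow> 'b::ab_group_add"
  assumes G: "gauss_code G" "balanced G" and F: "filamentation G F"
    and g: "g 0 = 0" "\<And>k. g (- k) = - g k"
    and T: "T \<subseteq> crossings G"
    and sat: "\<And>A B x y. \<lbrakk>A < length G; B < length G;
        Plus_end x \<in> set (G ! A); Minus_end y \<in> set (G ! A);
        Minus_end x \<in> set (G ! B); Plus_end y \<in> set (G ! B)\<rbrakk> \<Longrightarrow> x \<in> T \<longleftrightarrow> y \<in> T"
  shows "(\<Sum>x\<in>T. g (crossing_weight G x)) = 0"
proof -
  have fin: "finite (crossings G)" by (simp add: crossings_def)
  define h where "h x = (if x \<in> T then g (crossing_weight G x) else 0)" for x
  have "sum h f = 0" if "f \<in> F" for f
  proof -
    have "monofilament G f \<or> bifilament G f" using F that by (simp add: filamentation_def)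
    then show ?thesis
    proof
      assume "monofilament G f"
      then obtain x where "f = {x}" "crossing_weight G x = 0"
        unfolding monofilament_def using eta_self_crossing[OF G] by metis
      then show ?thesis by (simp add: h_def g(1))
    next
      assume "bifilament G f"
      then obtain x y A B where f: "f = {x, y}" "x \<noteq> y"
        and AB: "A < length G" "B < length G"
          "Plus_end x \<in> set (G ! A)" "Minus_end y \<in> set (G ! A)"
          "Minus_end x \<in> set (G ! B)" "Plus_end y \<in> set (G ! B)"
        and e: "eta (G ! A) (Plus_end x) (Minus_end y)
              + eta (G ! B) (Plus_end y) (Minus_end x) = 0"
        unfolding bifilament_def by blast
      have "crossing_weight G y = - crossing_weight G x"
        using eta_pair[OF G AB] e by linarith
      then show ?thesis using f sat[OF AB] by (simp add: h_def g(2))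
    qed
  qed
  then have "sum h (crossings G) = 0"
    using F sum.partition[OF fin, of F h] by (simp add: filamentation_def)
  moreover have "sum h (crossings G) = (\<Sum>x\<in>T. g (crossing_weight G x))"
    using T fin by (simp add: h_def sum.If_cases Int_absorb1)
  ultimately show ?thesis by simp
qed

lemma component_poly_eq_0:
  assumes G: "gauss_code G" "balanced G" and F: "filamentation G F" and A: "A < length G"
  shows "component_poly G A = 0"
proof -
  let ?g = "\<lambda>k. monomial_term k (Comp_var A) (nat \<bar>k\<bar>)"
  have "component_poly G A = (\<Sum>x\<in>self_crossings G A. ?g (crossing_weight G x))"
    unfolding component_poly_def
    by (intro sum.cong) (simp_all add: self_crossings_def eta_self_crossing[OF G A])
  also have "\<dots> = 0"
  proof (rule filamentation_sum_eq_0[OF G F])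
    fix C D x y
    assume *: "C < length G" "D < length G" "Plus_end x \<in> set (G ! C)" "Minus_end y \<in> set (G ! C)"
      "Minus_end x \<in> set (G ! D)" "Plus_end y \<in> set (G ! D)"
    have "x \<in> self_crossings G A \<longleftrightarrow> C = A \<and> D = A"
      using * crossing_in_crossings[OF *(1,3)] gauss_code_unique_component[OF G(1) _ A]
      by (auto simp: self_crossings_def)
    moreover have "y \<in> self_crossings G A \<longleftrightarrow> C = A \<and> D = A"
      using * crossing_in_crossings[OF *(1,4)] gauss_code_unique_component[OF G(1) _ A]
      by (auto simp: self_crossings_def)
    ultimately show "x \<in> self_crossings G A \<longleftrightarrow> y \<in> self_crossings G A" by simp
  qed (auto simp: monomial_term_def single_uminus self_crossings_def)
  finally show ?thesis .
qed

text \<open>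
  The weights make the two halves of a pair independent of each other, so the sum does not remember
  which \<open>AB\<close>-crossings the pairing has matched.
\<close>

lemma sum_labelled_pairs:
  assumes G: "gauss_code G" "balanced G" and AB: "A < length G" "B < length G" "A \<noteq> B"
    and Q: "is_pairing G A B Q"
  shows "(\<Sum>(x, y)\<in>labelled_pairs G A B Q.
            eta (G ! A) (Plus_end x) (Minus_end y) + eta (G ! B) (Plus_end y) (Minus_end x))
       = (\<Sum>x\<in>mixed_crossings G A B. crossing_weight G x)"
proof -
  let ?L = "labelled_pairs G A B Q"
  have uniq: "c \<notin> set (G ! B)" if "c \<in> set (G ! A)" for c
    using gauss_code_unique_component[OF G(1) AB(1,2) that] AB(3) by blast
  have part: "partition_on (mixed_crossings G A B) Q" using Q by (simp add: is_pairing_def)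
  \<comment> \<open>The ends of the crossings of a pair determine which of the two is labelled first.\<close>
  have inj: "inj_on (\<lambda>(x, y). {x, y}) ?L"
    using uniq by (auto simp: inj_on_def labelled_pairs_def doubleton_eq_iff)
  have img: "(\<lambda>(x, y). {x, y}) ` ?L = Q"
  proof
    show "Q \<subseteq> (\<lambda>(x, y). {x, y}) ` ?L"
    proof
      fix p assume p: "p \<in> Q"
      with Q have "\<exists>x y. p = {x, y} \<and> x \<noteq> y \<and>
          (\<exists>C\<in>{A, B}. Plus_end x \<in> set (G ! C) \<and> Minus_end y \<in> set (G ! C))"
        unfolding is_pairing_def by (elim conjE bspec)
      then obtain x y C where xy: "p = {x, y}" "C \<in> {A, B}"
        "Plus_end x \<in> set (G ! C)" "Minus_end y \<in> set (G ! C)"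
        by (elim exE conjE bexE)
      have mixed: "x \<in> mixed_crossings G A B" "y \<in> mixed_crossings G A B"
        using partition_onD1[OF part] p xy(1) by blast+
      from xy(2) show "p \<in> (\<lambda>(x, y). {x, y}) ` ?L"
      proof (elim insertE emptyE)
        assume C: "C = A"
        then have "Minus_end x \<in> set (G ! B)" "Plus_end y \<in> set (G ! B)"
          using xy(3,4) mixed uniq unfolding mixed_crossings_def by blast+
        then have "(x, y) \<in> ?L" using xy C p by (simp add: labelled_pairs_def)
        then show ?thesis using xy(1) by (metis (no_types, lifting) case_prod_conv image_eqI)
      next
        assume C: "C = B"
        then have "Minus_end x \<in> set (G ! A)" "Plus_end y \<in> set (G ! A)"
          using xy(3,4) mixed uniq unfolding mixed_crossings_def by blast+
        moreover have "{y, x} \<in> Q" using xy(1) p by (simp add: insert_commute)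
        ultimately have "(y, x) \<in> ?L" using xy C by (simp add: labelled_pairs_def)
        moreover have "p = {y, x}" using xy(1) by (simp add: insert_commute)
        ultimately show ?thesis by (metis (no_types, lifting) case_prod_conv image_eqI)
      qed
    qed
  qed (auto simp: labelled_pairs_def)
  have "(\<Sum>(x, y)\<in>?L.
            eta (G ! A) (Plus_end x) (Minus_end y) + eta (G ! B) (Plus_end y) (Minus_end x))
      = (\<Sum>(x, y)\<in>?L. sum (crossing_weight G) {x, y})"
  proof (intro sum.cong refl, clarify)
    fix x y assume "(x, y) \<in> ?L"
    then have *: "Plus_end x \<in> set (G ! A)" "Minus_end y \<in> set (G ! A)"
      "Minus_end x \<in> set (G ! B)" "Plus_end y \<in> set (G ! B)"
      by (auto simp: labelled_pairs_def)
    then have "x \<noteq> y" using uniq by auto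
    then show "eta (G ! A) (Plus_end x) (Minus_end y) + eta (G ! B) (Plus_end y) (Minus_end x)
        = sum (crossing_weight G) {x, y}"
      using eta_pair[OF G AB(1,2) *] by simp
  qed
  also have "\<dots> = (\<Sum>p\<in>(\<lambda>(x, y). {x, y}) ` ?L. sum (crossing_weight G) p)"
    by (subst sum.reindex[OF inj]) (simp add: case_prod_beta)
  also have "\<dots> = (\<Sum>x\<in>mixed_crossings G A B. crossing_weight G x)"
    unfolding img using sum.partition[OF _ part, of "crossing_weight G"]
    by (simp add: mixed_crossings_def crossings_def)
  finally show ?thesis .
qed

lemma pair_poly_eq_0:
  assumes G: "gauss_code G" "balanced G" and F: "filamentation G F"
    and AB: "A < length G" "B < length G" "A \<noteq> B" and Q: "is_pairing G A B Q"
  shows "pair_poly G A B Q = 0"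
proof -
  have "(\<Sum>x\<in>mixed_crossings G A B. crossing_weight G x) = 0"
  proof (rule filamentation_sum_eq_0[OF G F, where g = "\<lambda>k. k"])
    fix C D x y
    assume *: "C < length G" "D < length G" "Plus_end x \<in> set (G ! C)" "Minus_end y \<in> set (G ! C)"
      "Minus_end x \<in> set (G ! D)" "Plus_end y \<in> set (G ! D)"
    note uniq = gauss_code_unique_component[OF G(1) _ AB(1)]
      gauss_code_unique_component[OF G(1) _ AB(2)]
    have "x \<in> mixed_crossings G A B \<longleftrightarrow> C = A \<and> D = B \<or> C = B \<and> D = A"
      using * crossing_in_crossings[OF *(1,3)] uniq by (auto simp: mixed_crossings_def)
    moreover have "y \<in> mixed_crossings G A B \<longleftrightarrow> C = A \<and> D = B \<or> C = B \<and> D = A"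
      using * crossing_in_crossings[OF *(1,4)] uniq by (auto simp: mixed_crossings_def)
    ultimately show "x \<in> mixed_crossings G A B \<longleftrightarrow> y \<in> mixed_crossings G A B" by simp
  qed (auto simp: mixed_crossings_def)
  then show ?thesis
    by (simp add: pair_poly_def sum_labelled_pairs[OF G AB Q] monomial_term_def)
qed

theorem theoremC:
  fixes G :: "'x code" and P :: "nat set \<Rightarrow> 'x set set"
  assumes "gauss_code G"
    and "balanced G"
    and "\<exists>F. filamentation G F"
    and "pairing_choice G P"
  shows "link_poly G P = 0"
proof -
  obtain F where F: "filamentation G F" using assms(3) by blast
  have "pair_poly G A B (P {A, B}) = 0" if "A < B" "B < length G" for A B
    using pair_poly_eq_0[OF assms(1,2) F] assms(4) that by (simp add: pairing_choice_def)
  then have "(\<Sum>(A, B)\<in>{(A, B). A < B \<and> B < length G}. pair_poly G A B (P {A, B})) = 0"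
    by (intro sum.neutral) auto
  moreover have "(\<Sum>A<length G. component_poly G A) = 0"
    using component_poly_eq_0[OF assms(1,2) F] by (intro sum.neutral) auto
  ultimately show ?thesis by (simp add: link_poly_def)
qed

end
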